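(* Let $\{a_k\}_{k\ge 1}$ be an arbitrary sequence of positive numbers, let $A_k=\sum_{i=1}^k a_i$ (so $A_0=0$), and let the contracting coefficients be $\gamma_k=\frac{a_{k+1}}{A_{k+1}}$ for $k\ge 0$. Then for all points of the sequence $\{x_k\}_{k\ge 0}$ generated by the Conceptual Contracting-Point Method I (described in the context) with these coefficients and with tolerances $\delta_{k+1}\ge 0$, $k\ge 0$, we have $$A_kF(x_k)\;\le\; A_kF^*+B_k,\qquad k\ge 0,\qquad\text{where } B_k=\sum_{i=1}^k A_i\delta_i .$$
   Context: Setting. $\mathbb{E}$ is a finite-dimensional real vector space. The problem is $F^*=\min_{x\in\mathrm{dom}\,\psi}[F(x)=f(x)+\psi(x)]$, where $\psi:\mathbb{E}\to\mathbb{R}\cup\{+\infty\}$ is a proper closed convex function with bounded domain $\mathrm{dom}\,\psi=\{x:\psi(x)<+\infty\}$, and $f$ is convex and $p\ge 1$ times continuously differentiable at every point of $\mathrm{dom}\,\psi$. For $x_k\in\mathrm{dom}\,\psi$ and $\gamma_k\in(0,1]$, and for $y=(1-\gamma_k)x_k+\gamma_k v$ with $v\in\mathrm{dom}\,\psi$, put $S_k(y)=\gamma_k\psi\bigl(x_k+\frac{1}{\gamma_k}(y-x_k)\bigr)=\gamma_k\psi(v)$ and $F_k(y)=f(y)+S_k(y)$. Let $F_k^*$ denote the minimum of $F_k(y)$ over all $y=(1-\gamma_k)x_k+\gamma_k v$, $v\in\mathrm{dom}\,\psi$. Conceptual Contracting-Point Method I. Choose $x_0\in\mathrm{dom}\,\psi$.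 At iteration $k\ge 0$: (1) choose $\gamma_k\in(0,1]$; (2) for some $\delta_{k+1}\ge 0$ find a point $\bar x_{k+1}=(1-\gamma_k)x_k+\gamma_k\bar v_{k+1}$ with $\bar v_{k+1}\in\mathrm{dom}\,\psi$ such that $F_k(\bar x_{k+1})-F_k^*\le\delta_{k+1}$; (3) if $F(\bar x_{k+1})\le F(x_k)$ set $x_{k+1}=\bar x_{k+1}$, else set $x_{k+1}=x_k$. *)

theory Defs
  imports "HOL-Analysis.Analysis"
begin

text \<open>Functions \<open>\<psi> : E \<rightarrow> \<real> \<union> {+\<infinity>}\<close> are modelled with values in \<^typ>\<open>ereal\<close>; the value \<open>-\<infinity>\<close> is
  excluded by \<open>proper_fun\<close>.\<close>

definition edom :: "('a \<Rightarrow> ereal) \<Rightarrow> 'a set" where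
  "edom \<psi> = {x. \<psi> x < \<infinity>}"

definition ereal_epigraph :: "('a \<Rightarrow> ereal) \<Rightarrow> ('a \<times> real) set" where
  "ereal_epigraph \<psi> = {(x, r). \<psi> x \<le> ereal r}"

definition proper_fun :: "('a \<Rightarrow> ereal) \<Rightarrow> bool" where
  "proper_fun \<psi> \<longleftrightarrow> (\<forall>x. \<psi> x \<noteq> -\<infinity>) \<and> edom \<psi> \<noteq> {}"

definition proper_closed_convex :: "('a::real_normed_vector \<Rightarrow> ereal) \<Rightarrow> bool" where
  "proper_closed_convex \<psi> \<longleftrightarrow>
     proper_fun \<psi> \<and> closed (ereal_epigraph \<psi>) \<and> convex (ereal_epigraph \<psi>)"

text \<open>\<open>n\<close> times continuous differentiability at a point: all derivatives up to order \<open>n\<close> exist in a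
  neighbourhood of \<open>x\<close>, and those of order \<open>n\<close> are continuous at \<open>x\<close>. Derivatives of order \<open>n\<close> are
  represented by their values \<open>D\<^sup>n f(\<cdot>)[v\<^sub>1, \<dots>, v\<^sub>n]\<close> on fixed directions, so that the recursion stays
  within one type; in finite dimension this is the same as using the derivatives as multilinear maps.\<close>

primrec times_cont_diff_at :: "nat \<Rightarrow> ('a::real_normed_vector \<Rightarrow> real) \<Rightarrow> 'a \<Rightarrow> bool" where
  "times_cont_diff_at 0 f x \<longleftrightarrow> isCont f x"
| "times_cont_diff_at (Suc n) f x \<longleftrightarrow>
     (\<forall>\<^sub>F y in nhds x. f differentiable (at y)) \<and>
     (\<forall>v. times_cont_diff_at n (\<lambda>y. frechet_derivative f (at y) v) x)"

definition objective :: "('a \<Rightarrow> real) \<Rightarrow> ('a \<Rightarrow> ereal) \<Rightarrow> 'a \<Rightarrow> ereal" where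
  "objective f \<psi> x = ereal (f x) + \<psi> x"

text \<open>Under the assumptions on \<open>f\<close> and \<open>\<psi>\<close> the two infima below are finite and attained, so they are
  the minimal values.\<close>

definition optimal_value :: "('a \<Rightarrow> real) \<Rightarrow> ('a \<Rightarrow> ereal) \<Rightarrow> ereal" where
  "optimal_value f \<psi> = (INF x\<in>edom \<psi>. objective f \<psi> x)"

definition contracted_term :: "('a::real_vector \<Rightarrow> ereal) \<Rightarrow> real \<Rightarrow> 'a \<Rightarrow> 'a \<Rightarrow> ereal" where
  "contracted_term \<psi> \<gamma> x y = ereal \<gamma> * \<psi> (x + (1 / \<gamma>) *\<^sub>R (y - x))"

definition contracted_objective ::
    "('a::real_vector \<Rightarrow> real) \<Rightarrow> ('a \<Rightarrow> ereal) \<Rightarrow> real \<Rightarrow> 'a \<Rightarrow> 'a \<Rightarrow> ereal" where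
  "contracted_objective f \<psi> \<gamma> x y = ereal (f y) + contracted_term \<psi> \<gamma> x y"

definition contracted_optimal_value ::
    "('a::real_vector \<Rightarrow> real) \<Rightarrow> ('a \<Rightarrow> ereal) \<Rightarrow> real \<Rightarrow> 'a \<Rightarrow> ereal" where
  "contracted_optimal_value f \<psi> \<gamma> x =
     (INF y \<in> (\<lambda>v. (1 - \<gamma>) *\<^sub>R x + \<gamma> *\<^sub>R v) ` edom \<psi>. contracted_objective f \<psi> \<gamma> x y)"

text \<open>One iteration from \<open>x\<close> to \<open>x'\<close>, with coefficient \<open>\<gamma>\<close> and tolerance \<open>\<delta>\<close>; the trial point \<open>xb\<close>
  may be any \<open>\<delta>\<close>-approximate minimizer, so this is a relation and not a function.\<close>

definition contracting_point_step ::
    "('a::real_vector \<Rightarrow> real) \<Rightarrow> ('a \<Rightarrow> ereal) \<Rightarrow> real \<Rightarrow> real \<Rightarrow> 'a \<Rightarrow> 'a \<Rightarrow> bool" where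
  "contracting_point_step f \<psi> \<gamma> \<delta> x x' \<longleftrightarrow>
     (\<exists>vb\<in>edom \<psi>. \<exists>xb. xb = (1 - \<gamma>) *\<^sub>R x + \<gamma> *\<^sub>R vb \<and>
        contracted_objective f \<psi> \<gamma> x xb - contracted_optimal_value f \<psi> \<gamma> x \<le> ereal \<delta> \<and>
        x' = (if objective f \<psi> xb \<le> objective f \<psi> x then xb else x))"

definition contracting_point_method_I ::
    "('a::real_vector \<Rightarrow> real) \<Rightarrow> ('a \<Rightarrow> ereal) \<Rightarrow> (nat \<Rightarrow> real) \<Rightarrow> (nat \<Rightarrow> real) \<Rightarrow> (nat \<Rightarrow> 'a) \<Rightarrow> bool"
  where
  "contracting_point_method_I f \<psi> \<gamma> \<delta> x \<longleftrightarrow>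
     x 0 \<in> edom \<psi> \<and>
     (\<forall>k. 0 < \<gamma> k \<and> \<gamma> k \<le> 1 \<and> 0 \<le> \<delta> (k + 1) \<and>
          contracting_point_step f \<psi> (\<gamma> k) (\<delta> (k + 1)) (x k) (x (k + 1)))"

end

theory Submission
  imports Defs
begin

text \<open>For \<open>v\<close> in the domain of \<open>\<psi>\<close>, comparing the trial point with \<open>(1 - \<gamma>) x\<^sub>k + \<gamma> v\<close> in the contracted
  problem and using the convexity of \<open>f\<close> and \<open>\<psi>\<close> gives
  \<open>F(x\<^sub>k\<^sub>+\<^sub>1) \<le> (1 - \<gamma>\<^sub>k) F(x\<^sub>k) + \<gamma>\<^sub>k F(v) + \<delta>\<^sub>k\<^sub>+\<^sub>1\<close>. Multiplied by \<open>A\<^sub>k\<^sub>+\<^sub>1\<close>, this telescopes, since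
  \<open>A\<^sub>k\<^sub>+\<^sub>1 (1 - \<gamma>\<^sub>k) = A\<^sub>k\<close> and \<open>A\<^sub>k\<^sub>+\<^sub>1 \<gamma>\<^sub>k = a\<^sub>k\<^sub>+\<^sub>1\<close>. Only
  at the end is the infimum over \<open>v\<close> taken.\<close>

lemma proper_fun_eq_ereal:
  assumes "proper_fun \<psi>" "x \<in> edom \<psi>"
  shows "\<psi> x = ereal (real_of_ereal (\<psi> x))"
  using assms by (cases "\<psi> x") (auto simp: proper_fun_def edom_def)

text \<open>Convexity is given through the epigraph, which contains the graph points over
  \<open>x\<close> and \<open>v\<close> because \<open>\<psi>\<close> is finite there; their
  combination stays in it. The right side is a real number, so the bound also places the combined
  point in \<open>edom \<psi>\<close>.\<close>

lemma proper_closed_convex_jensen: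
  assumes psi: "proper_closed_convex \<psi>" and dom: "x \<in> edom \<psi>" "v \<in> edom \<psi>" and t: "0 \<le> t" "t \<le> 1"
  shows "\<psi> ((1 - t) *\<^sub>R x + t *\<^sub>R v)
         \<le> ereal ((1 - t) * real_of_ereal (\<psi> x) + t * real_of_ereal (\<psi> v))"
proof -
  have "proper_fun \<psi>" and conv: "convex (ereal_epigraph \<psi>)"
    using psi by (auto simp: proper_closed_convex_def)
  then have "(x, real_of_ereal (\<psi> x)) \<in> ereal_epigraph \<psi>" "(v, real_of_ereal (\<psi> v)) \<in> ereal_epigraph \<psi>"
    using proper_fun_eq_ereal[of \<psi>] dom by (auto simp: ereal_epigraph_def)
  then have "(1 - t) *\<^sub>R (x, real_of_ereal (\<psi> x)) + t *\<^sub>R (v, real_of_ereal (\<psi> v)) \<in> ereal_epigraph \<psi>"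
    using conv t by (intro convexD) auto
  then show ?thesis by (simp add: ereal_epigraph_def)
qed

text \<open>The rescaling by \<open>1 / \<gamma>\<close> about \<open>x\<close> undoes the
  contraction and recovers \<open>v\<close>.\<close>

lemma contracted_objective_combination:
  assumes "\<gamma> \<noteq> 0"
  shows "contracted_objective f \<psi> \<gamma> x ((1 - \<gamma>) *\<^sub>R x + \<gamma> *\<^sub>R v)
         = ereal (f ((1 - \<gamma>) *\<^sub>R x + \<gamma> *\<^sub>R v)) + ereal \<gamma> * \<psi> v"
proof -
  have "(1 - \<gamma>) *\<^sub>R x + \<gamma> *\<^sub>R v - x = \<gamma> *\<^sub>R (v - x)"
    by (simp add: algebra_simps)
  then have "x + (1 / \<gamma>) *\<^sub>R ((1 - \<gamma>) *\<^sub>R x + \<gamma> *\<^sub>R v - x) = v"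
    using assms by simp
  then show ?thesis by (simp add: contracted_objective_def contracted_term_def)
qed

lemma objective_eq_ereal:
  assumes "proper_fun \<psi>" "x \<in> edom \<psi>"
  shows "objective f \<psi> x = ereal (f x + real_of_ereal (\<psi> x))"
  by (subst objective_def, subst proper_fun_eq_ereal[OF assms]) simp

lemma contracting_point_step_edom:
  assumes psi: "proper_closed_convex \<psi>" and "x \<in> edom \<psi>" "0 < \<gamma>" "\<gamma> \<le> 1"
    and step: "contracting_point_step f \<psi> \<gamma> \<delta> x x'"
  shows "x' \<in> edom \<psi>"
proof -
  obtain vb where "vb \<in> edom \<psi>" "x' = (1 - \<gamma>) *\<^sub>R x + \<gamma> *\<^sub>R vb \<or> x' = x"
    using step unfolding contracting_point_step_def by metis
  then show ?thesis
    using proper_closed_convex_jensen[of \<psi> x vb \<gamma>] assms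
    by (auto simp: edom_def intro: le_less_trans)
qed

lemma contracting_point_step_bound:
  assumes psi: "proper_closed_convex \<psi>" and f: "convex_on (edom \<psi>) f"
    and x: "x \<in> edom \<psi>" and v: "v \<in> edom \<psi>" and \<gamma>: "0 < \<gamma>" "\<gamma> \<le> 1"
    and step: "contracting_point_step f \<psi> \<gamma> \<delta> x x'"
  shows "real_of_ereal (objective f \<psi> x')
         \<le> (1 - \<gamma>) * real_of_ereal (objective f \<psi> x) + \<gamma> * real_of_ereal (objective f \<psi> v) + \<delta>"
proof -
  have proper: "proper_fun \<psi>"
    using psi by (simp add: proper_closed_convex_def)
  define P where "P = (\<lambda>u. real_of_ereal (\<psi> u))"
  define y where "y = (1 - \<gamma>) *\<^sub>R x + \<gamma> *\<^sub>R v"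
  have P: "\<psi> u = ereal (P u)" "objective f \<psi> u = ereal (f u + P u)" if "u \<in> edom \<psi>" for u
    using proper_fun_eq_ereal[OF proper that] objective_eq_ereal[OF proper that] by (simp_all add: P_def)
  obtain vb xb where vb: "vb \<in> edom \<psi>" and xb: "xb = (1 - \<gamma>) *\<^sub>R x + \<gamma> *\<^sub>R vb"
    and approx: "contracted_objective f \<psi> \<gamma> x xb - contracted_optimal_value f \<psi> \<gamma> x \<le> ereal \<delta>"
    and x': "x' = (if objective f \<psi> xb \<le> objective f \<psi> x then xb else x)"
    using step unfolding contracting_point_step_def by blast
  have "contracted_optimal_value f \<psi> \<gamma> x \<le> contracted_objective f \<psi> \<gamma> x y"
    unfolding contracted_optimal_value_def y_def using v by (intro INF_lower imageI)
  then have opt: "contracted_optimal_value f \<psi> \<gamma> x \<le> ereal (f y + \<gamma> * P v)"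
    using \<gamma> P(1)[OF v] by (simp add: y_def contracted_objective_combination)
  have "contracted_objective f \<psi> \<gamma> x xb = ereal (f xb + \<gamma> * P vb)"
    using \<gamma> P(1)[OF vb] by (simp add: xb contracted_objective_combination)
  \<comment> \<open>The optimal value is real: \<open>opt\<close> excludes \<infinity>, and
    -\<infinity> would make the difference in \<open>approx\<close> infinite.\<close>
  then have trial: "f xb + \<gamma> * P vb \<le> f y + \<gamma> * P v + \<delta>"
    using approx opt by (cases "contracted_optimal_value f \<psi> \<gamma> x") auto
  have psi_xb: "\<psi> xb \<le> ereal ((1 - \<gamma>) * P x + \<gamma> * P vb)"
    unfolding xb P_def using psi x vb \<gamma> by (intro proper_closed_convex_jensen) auto
  then have xb_dom: "xb \<in> edom \<psi>"
    by (auto simp: edom_def intro: le_less_trans)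
  have P_xb: "P xb \<le> (1 - \<gamma>) * P x + \<gamma> * P vb"
    using psi_xb P(1)[OF xb_dom] by simp
  have f_y: "f y \<le> (1 - \<gamma>) * f x + \<gamma> * f v"
    unfolding y_def using convex_onD[OF f, of \<gamma> x v] x v \<gamma> by simp
  \<comment> \<open>The trial point is rejected only if its objective exceeds that of
    \<open>x\<close>, so both branches satisfy this bound.\<close>
  have "real_of_ereal (objective f \<psi> x') \<le> f xb + P xb"
    using P(2)[OF x] P(2)[OF xb_dom] by (auto simp: x')
  \<comment> \<open>The term \<open>\<gamma> * P vb\<close>, which is all that depends on
    \<open>vb\<close> in the bound for \<open>P xb\<close>, is the contracted term on the left of
    \<open>trial\<close> and cancels.\<close>
  also have "\<dots> \<le> (1 - \<gamma>) * (f x + P x) + \<gamma> * (f v + P v) + \<delta>"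
    using trial P_xb f_y by (simp add: algebra_simps)
  finally show ?thesis
    using P(2)[OF x] P(2)[OF v] by simp
qed

theorem theorem1:
  fixes f :: "'a::real_normed_vector \<Rightarrow> real"
    and \<psi> :: "'a \<Rightarrow> ereal"
    and p :: nat
    and a A B \<gamma> \<delta> :: "nat \<Rightarrow> real"
    and x :: "nat \<Rightarrow> 'a"
  assumes finite_dim: "\<exists>S::'a set. finite S \<and> span S = UNIV"
    and psi: "proper_closed_convex \<psi>"
    and bounded_dom: "bounded (edom \<psi>)"
    and f_convex: "convex_on (edom \<psi>) f"
    and p: "p \<ge> 1"
    and f_smooth: "\<forall>z\<in>edom \<psi>. times_cont_diff_at p f z"
    and a_pos: "\<forall>k\<ge>1. a k > 0"
    and A: "\<forall>k. A k = (\<Sum>i=1..k. a i)"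
    and gamma: "\<forall>k. \<gamma> k = a (k + 1) / A (k + 1)"
    and delta: "\<forall>k. \<delta> (k + 1) \<ge> 0"
    and B: "\<forall>k. B k = (\<Sum>i=1..k. A i * \<delta> i)"
    and iterates: "contracting_point_method_I f \<psi> \<gamma> \<delta> x"
  shows "\<forall>k. ereal (A k) * objective f \<psi> (x k) \<le> ereal (A k) * optimal_value f \<psi> + ereal (B k)"
proof
  fix k
  have proper: "proper_fun \<psi>"
    using psi by (simp add: proper_closed_convex_def)
  define F where "F = (\<lambda>u. real_of_ereal (objective f \<psi> u))"
  have F: "objective f \<psi> u = ereal (F u)" if "u \<in> edom \<psi>" for u
    using objective_eq_ereal[OF proper that] by (simp add: F_def)
  have x0: "x 0 \<in> edom \<psi>"
    and step: "\<And>n. contracting_point_step f \<psi> (\<gamma> n) (\<delta> (n + 1)) (x n) (x (n + 1))"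
    and \<gamma>: "\<And>n. 0 < \<gamma> n" "\<And>n. \<gamma> n \<le> 1"
    using iterates by (auto simp: contracting_point_method_I_def)
  have x: "x n \<in> edom \<psi>" for n
    by (induction n) (use x0 contracting_point_step_edom[OF psi _ \<gamma> step] in auto)
  have A_pos: "A n > 0" if "n > 0" for n
    using that a_pos unfolding A[rule_format] by (intro sum_pos) auto
  \<comment> \<open>With \<open>v\<close> fixed throughout the induction, all arithmetic is over the
    reals.\<close>
  have bound: "A n * F (x n) \<le> A n * F v + B n" if v: "v \<in> edom \<psi>" for n v
  proof (induction n)
    case 0
    show ?case using A B by simp
  next
    case (Suc n)
    have A_Suc: "A (Suc n) = A n + a (Suc n)" and B_Suc: "B (Suc n) = B n + A (Suc n) * \<delta> (Suc n)"
      using A B by simp_all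
    have A\<gamma>: "A (Suc n) * \<gamma> n = a (Suc n)"
      using gamma A_pos[of "Suc n"] by simp
    have "A (Suc n) * F (x (Suc n)) \<le> A (Suc n) * ((1 - \<gamma> n) * F (x n) + \<gamma> n * F v + \<delta> (Suc n))"
      using contracting_point_step_bound[OF psi f_convex x v \<gamma> step, of n] A_pos[of "Suc n"]
      by (simp add: F_def)
    also have "\<dots> = (A (Suc n) - A (Suc n) * \<gamma> n) * F (x n) + A (Suc n) * \<gamma> n * F v
        + A (Suc n) * \<delta> (Suc n)"
      by (simp add: algebra_simps)
    also have "\<dots> = A n * F (x n) + a (Suc n) * F v + A (Suc n) * \<delta> (Suc n)"
      unfolding A\<gamma> by (simp add: A_Suc)
    also have "\<dots> \<le> A (Suc n) * F v + B (Suc n)"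
      using Suc by (simp add: A_Suc B_Suc algebra_simps)
    finally show ?case .
  qed
  show "ereal (A k) * objective f \<psi> (x k) \<le> ereal (A k) * optimal_value f \<psi> + ereal (B k)"
  \<comment> \<open>At \<open>k = 0\<close> the weight \<open>A k\<close> is zero and both sides
    vanish, since zero times any extended real is zero. Otherwise \<open>A k\<close> may be divided
    by.\<close>
  proof (cases "k = 0")
    case True
    then show ?thesis using A B by (simp flip: zero_ereal_def)
  next
    case False
    then have Ak: "A k > 0" using A_pos by simp
    \<comment> \<open>After isolating \<open>F v\<close> the left side is free of \<open>v\<close>,
      hence a lower bound for the infimum; multiplying by \<open>A k\<close> and adding
      \<open>B k\<close> then restores the claim.\<close>
    have "ereal (F (x k) - B k / A k) \<le> optimal_value f \<psi>"
      unfolding optimal_value_def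
    proof (rule INF_greatest)
      fix v assume v: "v \<in> edom \<psi>"
      show "ereal (F (x k) - B k / A k) \<le> objective f \<psi> v"
        using bound[OF v, of k] Ak by (simp add: F[OF v] field_simps)
    qed
    then have "ereal (A k) * ereal (F (x k) - B k / A k) + ereal (B k)
        \<le> ereal (A k) * optimal_value f \<psi> + ereal (B k)"
      using Ak by (intro add_right_mono ereal_mult_left_mono) auto
    moreover have "ereal (A k) * ereal (F (x k) - B k / A k) + ereal (B k) = ereal (A k * F (x k))"
      using Ak by (simp add: field_simps)
    ultimately show ?thesis using F[OF x] by simp
  qed
qed

end
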